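(* Let $T$ be a bounded linear operator on a complex Banach space such that $T^N=\mathrm{Id}$ for some integer $N\ge1$. Then for every $\alpha\in\mathbb{R}$, $$T^\alpha=\begin{cases}\displaystyle\frac1N\sum_{n=0}^{N-1}\sin\big(\pi(\alpha-n)\big)\cot\Big(\frac{\pi}{N}(\alpha-n)\Big)T^n&\text{if }N\text{ is even},\\[2ex]\displaystyle\frac1N\sum_{n=0}^{N-1}\sin\big(\pi(\alpha-n)\big)\csc\Big(\frac{\pi}{N}(\alpha-n)\Big)T^n&\text{if }N\text{ is odd}.\end{cases}$$
   Context: $\operatorname{sinc}(x)=\frac{\sin\pi x}{\pi x}$ for $x\neq0$ and $\operatorname{sinc}(0)=1$. The fractional power $T^\alpha$ is defined by interpolating the integer powers: $T^\alpha=\sum_{n\in\mathbb{Z}}\operatorname{sinc}(\alpha-n)T^n$, the sum being the limit of the symmetric partial sums $\sum_{|n|\le M}$ as $M\to\infty$. On the right-hand side, the functions $x\mapsto\sin(\pi x)\cot(\pi x/N)$ ($N$ even) and $x\mapsto\sin(\pi x)\csc(\pi x/N)$ ($N$ odd) are extended continuously to their removable singularities $x\in N\mathbb{Z}$. *)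

theory Defs
  imports "HOL-Analysis.Analysis" "HOL-Real_Asymp.Real_Asymp"
begin
text \<open>
  The real structure inherited from \<^class>\<open>banach\<close> is the restriction of the complex one.
\<close>

class complex_banach = banach +
  fixes scaleC :: "complex \<Rightarrow> 'a \<Rightarrow> 'a" (infixr \<open>*\<^sub>C\<close> 75)
  assumes scaleC_add_right: "c *\<^sub>C (x + y) = c *\<^sub>C x + c *\<^sub>C y"
    and scaleC_add_left: "(c + d) *\<^sub>C x = c *\<^sub>C x + d *\<^sub>C x"
    and scaleC_scaleC: "c *\<^sub>C (d *\<^sub>C x) = (c * d) *\<^sub>C x"
    and scaleC_one: "1 *\<^sub>C x = x"
    and scaleC_of_real: "complex_of_real r *\<^sub>C x = r *\<^sub>R x"
    and norm_scaleC: "norm (c *\<^sub>C x) = cmod c * norm x"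

instantiation complex :: complex_banach
begin
definition scaleC_complex :: "complex \<Rightarrow> complex \<Rightarrow> complex" where
  "scaleC_complex c z = c * z"
instance
  by standard (auto simp: scaleC_complex_def algebra_simps norm_mult scaleR_conv_of_real)
end

lemma vector_space_scaleC:
  "vector_space (scaleC :: complex \<Rightarrow> 'a \<Rightarrow> 'a::complex_banach)"
  by standard (simp_all add: scaleC_add_right scaleC_add_left scaleC_scaleC scaleC_one)

text \<open>
  A bounded operator on a complex Banach space is an element of \<^typ>\<open>'a \<Rightarrow>\<^sub>L 'a\<close>
  (bounded and real-linear) that is in addition complex-linear.
\<close>

definition complex_linear_op :: "('a::complex_banach \<Rightarrow>\<^sub>L 'a) \<Rightarrow> bool" where
  "complex_linear_op T \<longleftrightarrow> Vector_Spaces.linear scaleC scaleC (blinfun_apply T)"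

definition blinfun_pow :: "('a::real_normed_vector \<Rightarrow>\<^sub>L 'a) \<Rightarrow> nat \<Rightarrow> ('a \<Rightarrow>\<^sub>L 'a)" where
  "blinfun_pow T n = ((\<lambda>S. T o\<^sub>L S) ^^ n) id_blinfun"

text \<open>Meaningful only if a bounded two-sided inverse exists.\<close>

definition blinfun_inv :: "('a::real_normed_vector \<Rightarrow>\<^sub>L 'a) \<Rightarrow> ('a \<Rightarrow>\<^sub>L 'a)" where
  "blinfun_inv T = (THE S. S o\<^sub>L T = id_blinfun \<and> T o\<^sub>L S = id_blinfun)"

lemma blinfun_inv_eqI:
  assumes "S o\<^sub>L T = id_blinfun" "T o\<^sub>L S = id_blinfun"
  shows "blinfun_inv T = S"
  unfolding blinfun_inv_def
proof (rule the_equality)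
  fix R assume "R o\<^sub>L T = id_blinfun \<and> T o\<^sub>L R = id_blinfun"
  then have R: "\<And>x. R (T x) = x"
    by (metis blinfun_apply_blinfun_compose blinfun_apply_id_blinfun)
  have S: "\<And>x. T (S x) = x"
    using assms(2) by (metis blinfun_apply_blinfun_compose blinfun_apply_id_blinfun)
  show "R = S" by (rule blinfun_eqI) (metis R S)
qed (use assms in simp)

definition blinfun_powi :: "('a::real_normed_vector \<Rightarrow>\<^sub>L 'a) \<Rightarrow> int \<Rightarrow> ('a \<Rightarrow>\<^sub>L 'a)" where
  "blinfun_powi T k =
     (if k \<ge> 0 then blinfun_pow T (nat k) else blinfun_pow (blinfun_inv T) (nat (- k)))"

definition nsinc :: "real \<Rightarrow> real" where
  "nsinc x = (if x = 0 then 1 else sin (pi * x) / (pi * x))"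

definition frac_power_partial ::
    "('a::real_normed_vector \<Rightarrow>\<^sub>L 'a) \<Rightarrow> real \<Rightarrow> nat \<Rightarrow> ('a \<Rightarrow>\<^sub>L 'a)" where
  "frac_power_partial T \<alpha> M =
     (\<Sum>n\<in>{- int M..int M}. nsinc (\<alpha> - of_int n) *\<^sub>R blinfun_powi T n)"

text \<open>
  The limit is taken in the operator norm. Since \<^const>\<open>lim\<close> is total, a value of this
  constant is informative only together with convergence of the partial sums.
\<close>

definition frac_power :: "('a::banach \<Rightarrow>\<^sub>L 'a) \<Rightarrow> real \<Rightarrow> ('a \<Rightarrow>\<^sub>L 'a)" where
  "frac_power T \<alpha> = lim (frac_power_partial T \<alpha>)"

definition csc :: "real \<Rightarrow> real" where
  "csc x = 1 / sin x"

definition continuous_ext :: "real set \<Rightarrow> (real \<Rightarrow> real) \<Rightarrow> real \<Rightarrow> real" where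
  "continuous_ext S f x = (if x \<in> S then Lim (at x) f else f x)"

definition int_multiples :: "nat \<Rightarrow> real set" where
  "int_multiples N = {real N * of_int k | k. True}"

definition sin_cot :: "nat \<Rightarrow> real \<Rightarrow> real" where
  "sin_cot N = continuous_ext (int_multiples N) (\<lambda>x. sin (pi * x) * cot (pi / real N * x))"

definition sin_csc :: "nat \<Rightarrow> real \<Rightarrow> real" where
  "sin_csc N = continuous_ext (int_multiples N) (\<lambda>x. sin (pi * x) * csc (pi / real N * x))"

text \<open>The limits used in the two extensions exist, so neither involves an arbitrary value.\<close>

lemma sin_cot_tendsto:
  assumes "N \<ge> 1" "even N"
  shows "((\<lambda>x. sin (pi * x) * cot (pi / real N * x)) \<longlongrightarrow> real N) (at (real N * of_int k))"
proof -
  obtain m where m: "N = 2 * m" using assms by auto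
  have N: "real N > 0" using assms by simp
  have s: "sin (pi * (real N * of_int k + h)) = sin (pi * h)" for h
  proof -
    have "pi * (real N * of_int k + h) = pi * h + pi * of_int (2 * (int m * k))"
      by (simp add: m algebra_simps)
    then show ?thesis
      by (simp only: sin_add sin_npi_int cos_npi_int) simp
  qed
  have c: "cot (pi / real N * (real N * of_int k + h)) = cot (pi * h / real N)" for h
  proof -
    have "pi / real N * (real N * of_int k + h) = pi * h / real N + pi * of_int k"
      using N by (simp add: field_simps)
    moreover have "cos (pi * of_int k) \<noteq> (0::real)"
      by (simp add: cos_npi_int)
    ultimately show ?thesis
      by (simp add: cot_def sin_add cos_add sin_npi_int)
  qed
  have "((\<lambda>h. sin (pi * h) * cot (pi * h / real N)) \<longlongrightarrow> real N) (at 0)"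
    unfolding cot_def using N by real_asymp
  then have "((\<lambda>h. sin (pi * (real N * of_int k + h)) *
      cot (pi / real N * (real N * of_int k + h))) \<longlongrightarrow> real N) (at 0)"
    unfolding s c .
  then show ?thesis
    by (subst LIM_offset_zero_iff) simp_all
qed

lemma sin_csc_tendsto:
  assumes "odd N"
  shows "((\<lambda>x. sin (pi * x) * csc (pi / real N * x)) \<longlongrightarrow> real N) (at (real N * of_int k))"
proof -
  have N: "real N > 0" using assms by (simp add: odd_pos)
  have s: "sin (pi * (real N * of_int k + h)) = (if even k then 1 else -1) * sin (pi * h)" for h
  proof -
    have "pi * (real N * of_int k + h) = pi * h + pi * of_int (int N * k)"
      by (simp add: algebra_simps)
    then show ?thesis using assms
      by (simp only: sin_add sin_npi_int cos_npi_int) simp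
  qed
  have c: "csc (pi / real N * (real N * of_int k + h))
      = (if even k then 1 else -1) * csc (pi * h / real N)" for h
  proof -
    have "pi / real N * (real N * of_int k + h) = pi * h / real N + pi * of_int k"
      using N by (simp add: field_simps)
    then show ?thesis
      by (simp add: csc_def sin_add sin_npi_int cos_npi_int)
  qed
  have "((\<lambda>h. sin (pi * h) * csc (pi * h / real N)) \<longlongrightarrow> real N) (at 0)"
    unfolding csc_def using N by real_asymp
  then have "((\<lambda>h. sin (pi * (real N * of_int k + h)) *
      csc (pi / real N * (real N * of_int k + h))) \<longlongrightarrow> real N) (at 0)"
    unfolding s c by (cases "even k") simp_all
  then show ?thesis
    by (subst LIM_offset_zero_iff) simp_all
qed

end

theory Submission
  imports Defs
begin

text \<open>
  Since \<open>T\<close> has period \<open>P\<close>, the coefficient of \<open>T ^ r\<close> in the symmetric partial sums is the sum of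
  \<open>sinc (\<alpha> - n)\<close> over the residue class of \<open>r\<close> modulo \<open>P\<close>. For even \<open>P\<close> the numerators
  \<open>sin (\<pi> (\<alpha> - n))\<close> are constant on this class, and what remains is the partial fraction expansion
  of the cotangent, which follows from the reflection formula of the Digamma function. An odd \<open>N\<close>
  is treated as the even period \<open>2 N\<close>.
\<close>

section \<open>Partial fractions of the cotangent\<close>

text \<open>Logarithmic differentiation of the Gamma reflection formula, kept free of quotients:
  \<open>Gamma t * Gamma (1 - t) * sin (pi * t)\<close> is constant off the integers, so its
  derivative vanishes, and the nonzero Gamma factors can be divided out.\<close>

lemma Digamma_reflection_real:
  fixes x :: real
  assumes x: "x \<notin> \<int>"
  shows "Digamma (1 - x) - Digamma x = pi * cot (pi * x)"
proof -
  have sin: "sin (pi * t) \<noteq> 0" if "t \<notin> \<int>" for t :: real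
    using that by (metis Ints_of_int sin_zero_iff_int2 mult.commute mult_cancel_left pi_neq_zero)
  have 1: "1 - x \<notin> \<int>" using x by (metis Ints_1 Ints_diff diff_diff_eq2 add_diff_cancel_left')
  have n: "x \<notin> \<int>\<^sub>\<le>\<^sub>0" "1 - x \<notin> \<int>\<^sub>\<le>\<^sub>0" using x 1 nonpos_Ints_Int by auto
  have reflection: "Gamma t * Gamma (1 - t) * sin (pi * t) = pi" if "t \<notin> \<int>" for t :: real
  proof -
    have "complex_of_real (Gamma t * Gamma (1 - t)) = of_real (pi / sin (pi * t))"
      using Gamma_reflection_complex[of "of_real t"]
      by (simp add: Gamma_complex_of_real[symmetric] sin_of_real[symmetric])
    then show ?thesis using sin[OF that] unfolding of_real_eq_iff by simp
  qed
  have "((\<lambda>t. Gamma t * Gamma (1 - t) * sin (pi * t)) has_real_derivative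
      Gamma x * Gamma (1 - x) * ((Digamma x - Digamma (1 - x)) * sin (pi * x) + pi * cos (pi * x))) (at x)"
    using n by (auto intro!: derivative_eq_intros simp: algebra_simps)
  \<comment> \<open>The complement of the integers is open, so the product is constant on a
    neighbourhood of \<open>x\<close>; uniqueness of the derivative then gives the identity.\<close>
  moreover have "\<forall>\<^sub>F t in nhds x. Gamma t * Gamma (1 - t) * sin (pi * t) = pi"
    using eventually_nhds_in_open[of "- \<int>" x] x reflection
    by (auto elim!: eventually_mono simp: open_Compl)
  then have "((\<lambda>t. Gamma t * Gamma (1 - t) * sin (pi * t)) has_real_derivative 0) (at x)"
    by (subst DERIV_cong_ev[OF refl _ refl]) auto
  ultimately have "Gamma x * Gamma (1 - x) *
      ((Digamma x - Digamma (1 - x)) * sin (pi * x) + pi * cos (pi * x)) = 0"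
    by (rule DERIV_unique)
  then have "(Digamma x - Digamma (1 - x)) * sin (pi * x) + pi * cos (pi * x) = 0"
    using n by (simp add: Gamma_eq_zero_iff)
  then show ?thesis using sin[OF x] by (simp add: cot_def field_simps)
qed

text \<open>The half-open interval gives both halves exactly \<open>m\<close> terms, which is what
  lets the two logarithms cancel in \<open>cot_partial_fractions\<close>.\<close>

lemma sum_symmetric_int:
  fixes f :: "int \<Rightarrow> 'b::comm_monoid_add"
  shows "(\<Sum>k\<in>{- int m..<int m}. f k) = (\<Sum>n<m. f (int n)) + (\<Sum>n<m. f (- int n - 1))"
proof (induction m)
  case (Suc m)
  have "{- int (Suc m)..<int (Suc m)} = insert (int m) (insert (- int m - 1) {- int m..<int m})"
    by auto
  then show ?case using Suc by (simp add: ac_simps)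
qed simp

text \<open>In the limit formula for Digamma, the terms \<open>k = n\<close> belong to the argument
  \<open>- y\<close> and the terms \<open>k = - n - 1\<close> to \<open>1 + y\<close>; the
  reflection formula at \<open>- y\<close> evaluates the difference of the two limits.\<close>

lemma cot_partial_fractions:
  fixes y :: real
  assumes y: "y \<notin> \<int>"
  shows "(\<lambda>m. \<Sum>k\<in>{- int m..<int m}. 1 / (y - of_int k)) \<longlonglongrightarrow> pi * cot (pi * y)"
proof -
  have nz: "- y \<noteq> 0" "1 + y \<noteq> 0" and my: "- y \<notin> \<int>"
    using y by (auto simp: add_eq_0_iff)
  have "(\<lambda>m. (ln (real m) - (\<Sum>n<m. inverse (- y + of_nat n))) -
      (ln (real m) - (\<Sum>n<m. inverse (1 + y + of_nat n)))) \<longlonglongrightarrow> Digamma (- y) - Digamma (1 + y)"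
    using tendsto_diff[OF Digamma_LIMSEQ[OF nz(1)] Digamma_LIMSEQ[OF nz(2)]] by simp
  moreover have "Digamma (- y) - Digamma (1 + y) = pi * cot (pi * y)"
    using Digamma_reflection_real[OF my] by simp
  moreover have "(ln (real m) - (\<Sum>n<m. inverse (- y + of_nat n))) -
      (ln (real m) - (\<Sum>n<m. inverse (1 + y + of_nat n))) =
      (\<Sum>k\<in>{- int m..<int m}. 1 / (y - of_int k))" for m
  proof -
    have "(\<Sum>n<m. 1 / (y - real n)) = - (\<Sum>n<m. inverse (- y + of_nat n))"
      unfolding sum_negf[symmetric]
      by (intro sum.cong refl) (metis inverse_eq_divide inverse_minus_eq minus_diff_eq uminus_add_conv_diff)
    then show ?thesis by (simp add: sum_symmetric_int inverse_eq_divide algebra_simps)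
  qed
  ultimately show ?thesis by simp
qed

section \<open>Sinc at integers and at infinity, and values of the extended kernels\<close>

lemma nsinc_of_int: "nsinc (of_int j) = (if j = 0 then 1 else 0)"
  by (simp add: nsinc_def sin_npi_int mult.commute)

lemma tendsto_nsinc_at_infinity: "(nsinc \<longlongrightarrow> 0) at_infinity"
proof (rule Lim_null_comparison)
  show "\<forall>\<^sub>F x in at_infinity. norm (nsinc x) \<le> inverse (norm x)"
    unfolding eventually_at_infinity
  proof (intro exI allI impI)
    fix x :: real assume x: "1 \<le> norm x"
    \<comment> \<open>The bound \<open>pi\<close>, weaker than 1, cancels the \<open>pi\<close> in
      the denominator.\<close>
    have "\<bar>sin (pi * x)\<bar> \<le> pi" using abs_sin_le_one[of "pi * x"] pi_ge_two by linarith
    then show "norm (nsinc x) \<le> inverse (norm x)"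
      using x by (simp add: nsinc_def abs_mult field_simps)
  qed
  show "((\<lambda>x::real. inverse (norm x)) \<longlongrightarrow> 0) at_infinity"
    by (intro tendsto_inverse_0_at_top filterlim_norm_at_top)
qed

lemma sin_cot_multiple:
  assumes "N \<ge> 1" "even N"
  shows "sin_cot N (real N * of_int k) = real N"
  using tendsto_Lim[OF _ sin_cot_tendsto[OF assms, of k]]
  by (auto simp: sin_cot_def continuous_ext_def int_multiples_def)

lemma sin_csc_multiple:
  assumes "odd N"
  shows "sin_csc N (real N * of_int k) = real N"
  using tendsto_Lim[OF _ sin_csc_tendsto[OF assms, of k]]
  by (auto simp: sin_csc_def continuous_ext_def int_multiples_def)

lemma sin_cot_nonmultiple:
  "x \<notin> int_multiples N \<Longrightarrow> sin_cot N x = sin (pi * x) * cot (pi / real N * x)"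
  by (simp add: sin_cot_def continuous_ext_def)

lemma sin_csc_nonmultiple:
  "x \<notin> int_multiples N \<Longrightarrow> sin_csc N x = sin (pi * x) * csc (pi / real N * x)"
  by (simp add: sin_csc_def continuous_ext_def)

section \<open>Sinc sums over residue classes\<close>

text \<open>For non-integer \<open>x\<close> the constant numerator factors out and the cotangent
  expansion at \<open>x / P\<close> applies. For integer \<open>x\<close> that expansion may be
  singular, but sinc is then a Kronecker delta and at most one term survives.\<close>

lemma sum_nsinc_arithmetic_progression:
  assumes P: "P \<ge> 1" "even P"
  shows "(\<lambda>m. \<Sum>k\<in>{- int m..<int m}. nsinc (x - real P * of_int k)) \<longlonglongrightarrow> sin_cot P x / real P"
proof (cases "x \<in> \<int>")
  case True
  then obtain j where j: "x = of_int j" by (auto elim: Ints_cases)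
  have eq: "nsinc (x - real P * of_int k) = (if j = int P * k then 1 else 0)" for k
    using nsinc_of_int[of "j - int P * k"] by (simp add: j)
  show ?thesis
  proof (cases "int P dvd j")
    case True
    then obtain k0 where k0: "j = int P * k0" by auto
    have eq': "nsinc (x - real P * of_int k) = (if k0 = k then 1 else 0)" for k
      using P by (simp add: eq k0)
    \<comment> \<open>The only nonzero term is at \<open>k0\<close>, which lies in the interval as
      soon as \<open>m\<close> exceeds its absolute value; the right end is open.\<close>
    have "\<forall>\<^sub>F m in sequentially. (\<Sum>k\<in>{- int m..<int m}. nsinc (x - real P * of_int k)) = 1"
      using eventually_gt_at_top[of "nat \<bar>k0\<bar>"]
      by eventually_elim (auto simp: eq')
    moreover have "sin_cot P x / real P = 1"
      using sin_cot_multiple[OF P, of k0] P by (simp add: j k0)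
    ultimately show ?thesis by (simp add: tendsto_eventually)
  next
    case False
    have "x \<notin> int_multiples P"
    proof
      assume "x \<in> int_multiples P"
      then obtain k where "of_int j = (of_int (int P * k) :: real)" by (auto simp: int_multiples_def j)
      then show False using False unfolding of_int_eq_iff by simp
    qed
    then have "sin_cot P x = 0"
      by (simp add: sin_cot_nonmultiple j sin_npi_int)
    moreover have "nsinc (x - real P * of_int k) = 0" for k
      using False by (auto simp: eq)
    ultimately show ?thesis by simp
  qed
next
  case False
  define y where "y = x / real P"
  have xy: "x = real P * y" using P by (simp add: y_def)
  have y: "y \<notin> \<int>" using False by (auto simp: xy)
  have "x \<notin> int_multiples P" using False by (auto simp: int_multiples_def)
  then have val: "sin_cot P x / real P = sin (pi * x) / (pi * real P) * (pi * cot (pi * y))"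
    by (simp add: sin_cot_nonmultiple xy)
  have "nsinc (x - real P * of_int k) = sin (pi * x) / (pi * real P) * (1 / (y - of_int k))" for k
  proof -
    obtain h where h: "P = 2 * h" using P by auto
    \<comment> \<open>Evenness of \<open>P\<close> enters here: the shift is a multiple of the full
      period \<open>2 * pi\<close>.\<close>
    have "pi * (x - real P * of_int k) = pi * x - pi * of_int (2 * (int h * k))"
      by (simp add: h algebra_simps)
    then have s: "sin (pi * (x - real P * of_int k)) = sin (pi * x)"
      by (simp only: sin_diff sin_npi_int cos_npi_int) simp
    have d: "x - real P * of_int k = real P * (y - of_int k)" by (simp add: xy algebra_simps)
    have "y - of_int k \<noteq> 0" using y by auto
    then have "x - real P * of_int k \<noteq> 0" using P by (simp add: d)
    then show ?thesis unfolding nsinc_def s by (simp add: d)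
  qed
  then show ?thesis
    using tendsto_mult_left[OF cot_partial_fractions[OF y], of "sin (pi * x) / (pi * real P)"]
    by (simp only: val sum_distrib_left)
qed

text \<open>Write \<open>M = P * q + s\<close>. Since \<open>r\<close> and \<open>s\<close> lie
  below \<open>P\<close>, the upper bound holds for \<open>k < q\<close>, fails for
  \<open>k > q\<close>, and reads \<open>r \<le> s\<close> at \<open>k = q\<close>; the lower bound
  holds for \<open>k \<ge> - q\<close>, fails for \<open>k \<le> - q - 2\<close>, and reads
  \<open>P \<le> r + s\<close> at \<open>k = - q - 1\<close>. This isolates a half-open block from
  at most two boundary terms.\<close>

lemma residue_class_in_symmetric_interval:
  fixes P r M :: nat
  assumes P: "P \<ge> 1" and r: "r < P"
  shows "{n \<in> {- int M..int M}. nat (n mod int P) = r} =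
    (\<lambda>k. int r + int P * k) `
      ({- int (M div P)..<int (M div P)} \<union>
       (if r + M mod P \<ge> P then {- int (M div P) - 1} else {}) \<union>
       (if r \<le> M mod P then {int (M div P)} else {}))"
    (is "?L = _ ` ?K")
proof -
  define q s where "q = int (M div P)" and "s = int (M mod P)"
  have M: "int M = int P * q + s"
    unfolding q_def s_def by (metis of_nat_add of_nat_mult mult_div_mod_eq)
  have s: "0 \<le> s" "s < int P" using P by (auto simp: s_def)
  have K: "k \<in> ?K \<longleftrightarrow> - int M \<le> int r + int P * k \<and> int r + int P * k \<le> int M" for k
  proof -
    have up: "int r + int P * k \<le> int M \<longleftrightarrow> k < q \<or> k = q \<and> int r \<le> s"
    proof (cases k q rule: linorder_cases)
      case less
      then have "int P * (k + 1) \<le> int P * q" using P by (intro mult_left_mono) auto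
      then show ?thesis using less r s by (simp add: M algebra_simps)
    next
      case greater
      then have "int P * (q + 1) \<le> int P * k" using P by (intro mult_left_mono) auto
      then show ?thesis using greater r s by (simp add: M algebra_simps)
    qed (auto simp: M)
    have low: "- int M \<le> int r + int P * k \<longleftrightarrow> - q \<le> k \<or> k = - q - 1 \<and> int P \<le> int r + s"
    proof -
      consider "- q \<le> k" | "k = - q - 1" | "k \<le> - q - 2" by linarith
      then show ?thesis
      proof cases
        case 1
        then have "int P * (- q) \<le> int P * k" using P by (intro mult_left_mono) auto
        then show ?thesis using 1 r s by (simp add: M algebra_simps)
      next
        case 2
        have "int P * k = - (int P * q) - int P" unfolding 2 by (simp add: algebra_simps)
        then show ?thesis using 2 by (auto simp: M)
      next
        case 3
        then have "int P * k \<le> int P * (- q - 2)" using P by (intro mult_left_mono) auto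
        then show ?thesis using 3 r s by (simp add: M algebra_simps)
      qed
    qed
    \<comment> \<open>With \<open>q\<close> nonnegative, the exceptional index at either end
      satisfies the opposite bound automatically.\<close>
    have q0: "0 \<le> q" by (simp add: q_def)
    have "int P \<le> int r + s \<longleftrightarrow> P \<le> r + M mod P" "int r \<le> s \<longleftrightarrow> r \<le> M mod P"
      unfolding s_def by linarith+
    then show ?thesis
      unfolding up low q_def[symmetric] using q0 by auto
  qed
  show ?thesis
  proof (intro equalityI subsetI)
    fix n assume n: "n \<in> ?L"
    then have "int r = n mod int P" using P by auto
    then have eq: "n = int r + int P * (n div int P)" by simp
    with n have "n div int P \<in> ?K" unfolding K by simp
    then show "n \<in> (\<lambda>k. int r + int P * k) ` ?K" using eq by (rule rev_image_eqI)
  next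
    fix n assume "n \<in> (\<lambda>k. int r + int P * k) ` ?K"
    then obtain k where "k \<in> ?K" and n: "n = int r + int P * k" by (rule imageE) blast
    then show "n \<in> ?L" using r unfolding K by simp
  qed
qed

text \<open>The block converges along \<open>M div P\<close> by the arithmetic progression result,
  and the boundary terms vanish because sinc decays.\<close>

lemma tendsto_nsinc_residue_class:
  assumes P: "P \<ge> 1" "even P" and r: "r < P"
  shows "(\<lambda>M. \<Sum>n\<in>{n \<in> {- int M..int M}. nat (n mod int P) = r}. nsinc (\<alpha> - of_int n))
    \<longlonglongrightarrow> sin_cot P (\<alpha> - real r) / real P"
proof -
  define f where "f = (\<lambda>k. nsinc (\<alpha> - real r - real P * of_int k))"
  define q where "q = (\<lambda>M::nat. M div P)"
  \<comment> \<open>The boundary terms switch on and off with \<open>M mod P\<close>; filling in 0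
    when absent lets them be dominated by values of \<open>f\<close> that tend to 0.\<close>
  define u where "u = (\<lambda>M::nat. if r + M mod P \<ge> P then f (- int (q M) - 1) else 0)"
  define v where "v = (\<lambda>M::nat. if r \<le> M mod P then f (int (q M)) else 0)"
  have q: "filterlim q at_top sequentially"
    unfolding filterlim_at_top eventually_sequentially q_def
  proof (intro allI)
    fix Z show "\<exists>N. \<forall>n\<ge>N. Z \<le> n div P"
      using P by (intro exI[of _ "Z * P"]) (auto simp: less_eq_div_iff_mult_less_eq)
  qed
  have p: "real P > 0" using P by simp
  have "(\<lambda>k. f (- int k - 1)) \<longlonglongrightarrow> 0" "(\<lambda>k. f (int k)) \<longlonglongrightarrow> 0"
    unfolding f_def
    by (rule filterlim_compose[OF tendsto_nsinc_at_infinity], simp, use p in real_asymp)+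
  then have f0: "(\<lambda>M. f (- int (q M) - 1)) \<longlonglongrightarrow> 0" "(\<lambda>M. f (int (q M))) \<longlonglongrightarrow> 0"
    using q by (auto intro: filterlim_compose)
  have "u \<longlonglongrightarrow> 0"
    by (rule Lim_null_comparison[OF _ tendsto_norm_zero[OF f0(1)]]) (simp add: u_def)
  moreover have "v \<longlonglongrightarrow> 0"
    by (rule Lim_null_comparison[OF _ tendsto_norm_zero[OF f0(2)]]) (simp add: v_def)
  moreover have "(\<lambda>M. \<Sum>k\<in>{- int (q M)..<int (q M)}. f k) \<longlonglongrightarrow> sin_cot P (\<alpha> - real r) / real P"
    using filterlim_compose[OF sum_nsinc_arithmetic_progression[OF P] q] unfolding f_def .
  moreover have "(\<Sum>n\<in>{n \<in> {- int M..int M}. nat (n mod int P) = r}. nsinc (\<alpha> - of_int n))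
      = (\<Sum>k\<in>{- int (q M)..<int (q M)}. f k) + u M + v M" for M
  proof -
    have inj: "inj_on (\<lambda>k. int r + int P * k) A" for A
      using P by (auto simp: inj_on_def)
    have f: "nsinc (\<alpha> - of_int (int r + int P * k)) = f k" for k
      by (simp add: f_def algebra_simps)
    show ?thesis
      unfolding residue_class_in_symmetric_interval[OF P(1) r] sum.reindex[OF inj] o_def f
      by (subst sum.union_disjoint) (auto simp: u_def v_def q_def sum.union_disjoint)
  qed
  ultimately show ?thesis
    using tendsto_add[OF tendsto_add] by fastforce
qed

section \<open>Integer powers of a periodic operator\<close>

lemma blinfun_pow_0: "blinfun_pow T 0 = id_blinfun"
  by (simp add: blinfun_pow_def)

lemma blinfun_pow_Suc: "blinfun_pow T (Suc n) = T o\<^sub>L blinfun_pow T n"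
  by (simp add: blinfun_pow_def)

lemma blinfun_apply_pow: "blinfun_apply (blinfun_pow T n) = (blinfun_apply T ^^ n)"
  by (induction n) (simp_all add: blinfun_pow_0 blinfun_pow_Suc fun_eq_iff)

lemma blinfun_pow_add: "blinfun_pow T (m + n) = blinfun_pow T m o\<^sub>L blinfun_pow T n"
  by (rule blinfun_eqI) (simp add: blinfun_apply_pow funpow_add)

lemma blinfun_pow_mult: "blinfun_pow T (m * n) = blinfun_pow (blinfun_pow T m) n"
  by (rule blinfun_eqI) (simp add: blinfun_apply_pow funpow_mult mult.commute)

lemma blinfun_pow_id: "blinfun_pow id_blinfun n = id_blinfun"
  by (rule blinfun_eqI) (simp add: blinfun_apply_pow id_def[symmetric])

lemma blinfun_pow_mod:
  assumes "blinfun_pow T P = id_blinfun"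
  shows "blinfun_pow T (n mod P) = blinfun_pow T n"
proof -
  have "blinfun_pow T n = blinfun_pow T (P * (n div P) + n mod P)" by simp
  also have "\<dots> = blinfun_pow T (n mod P)"
    unfolding blinfun_pow_add blinfun_pow_mult assms blinfun_pow_id
    by (rule blinfun_eqI) simp
  finally show ?thesis ..
qed

text \<open>For negative exponents, the inverse is \<open>blinfun_pow T (P - 1)\<close>, so the
  exponent \<open>- m\<close> becomes \<open>(P - 1) * m\<close>, which differs from it by the
  multiple \<open>P * m\<close> of the period.\<close>

lemma blinfun_powi_mod:
  assumes P: "P \<ge> 1" and T: "blinfun_pow T P = id_blinfun"
  shows "blinfun_powi T n = blinfun_pow T (nat (n mod int P))"
proof (cases "n \<ge> 0")
  case True
  then show ?thesis using blinfun_pow_mod[OF T, of "nat n"]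
    by (simp add: blinfun_powi_def nat_mod_distrib)
next
  case False
  obtain m where m: "n = - int m" using False by (metis nonpos_int_cases linorder_not_le less_imp_le)
  have inv: "blinfun_inv T = blinfun_pow T (P - 1)"
  proof (rule blinfun_inv_eqI)
    have 1: "blinfun_pow T 1 = T"
      by (rule blinfun_eqI) (simp add: blinfun_apply_pow)
    show "blinfun_pow T (P - 1) o\<^sub>L T = id_blinfun" "T o\<^sub>L blinfun_pow T (P - 1) = id_blinfun"
      using blinfun_pow_add[of T "P - 1" 1] blinfun_pow_add[of T 1 "P - 1"] P T by (simp_all add: 1[simplified])
  qed
  have "n mod int P = (int m * (int P - 1)) mod int P"
    unfolding m by (simp add: mod_eq_dvd_iff algebra_simps)
  also have "\<dots> = int (((P - 1) * m) mod P)"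
    using P by (simp add: zmod_int of_nat_diff mult.commute)
  finally have "blinfun_pow T (nat (n mod int P)) = blinfun_pow T ((P - 1) * m)"
    by (simp add: blinfun_pow_mod[OF T] del: of_nat_mod)
  also have "\<dots> = blinfun_powi T n"
    using False by (simp add: blinfun_powi_def inv m blinfun_pow_mult)
  finally show ?thesis ..
qed

section \<open>Limits of the symmetric partial sums, for even and for odd periods\<close>

text \<open>Grouping by residues leaves a fixed finite set of operators with scalar coefficients
  depending on \<open>M\<close>, so scalar convergence of the coefficients gives convergence in
  operator norm.\<close>

lemma frac_power_partial_tendsto_even:
  assumes P: "P \<ge> 1" "even P" and T: "blinfun_pow T P = id_blinfun"
  shows "frac_power_partial T \<alpha> \<longlonglongrightarrow>
    (\<Sum>r<P. (sin_cot P (\<alpha> - real r) / real P) *\<^sub>R blinfun_pow T r)"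
proof -
  have "frac_power_partial T \<alpha> = (\<lambda>M. \<Sum>r<P.
      (\<Sum>n\<in>{n \<in> {- int M..int M}. nat (n mod int P) = r}. nsinc (\<alpha> - of_int n)) *\<^sub>R blinfun_pow T r)"
  proof
    fix M
    have "(\<lambda>n. nat (n mod int P)) ` {- int M..int M} \<subseteq> {..<P}"
      using P by (auto simp: nat_less_iff)
    then have "frac_power_partial T \<alpha> M = (\<Sum>r<P. \<Sum>n\<in>{n \<in> {- int M..int M}. nat (n mod int P) = r}.
        nsinc (\<alpha> - of_int n) *\<^sub>R blinfun_powi T n)"
      unfolding frac_power_partial_def by (intro sum.group[symmetric]) auto
    also have "\<dots> = (\<Sum>r<P. (\<Sum>n\<in>{n \<in> {- int M..int M}. nat (n mod int P) = r}.
        nsinc (\<alpha> - of_int n)) *\<^sub>R blinfun_pow T r)"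
      unfolding scaleR_sum_left by (intro sum.cong refl) (simp add: blinfun_powi_mod[OF P(1) T])
    finally show "frac_power_partial T \<alpha> M = \<dots>" .
  qed
  then show ?thesis
    using tendsto_nsinc_residue_class[OF P]
    by (auto intro!: tendsto_sum tendsto_scaleR)
qed

text \<open>Away from the singularities this is \<open>cot w + tan w = 2 / sin (2 w)\<close> with \<open>w = \<pi> x / (2 N)\<close>.\<close>

lemma sin_cot_double:
  assumes N: "odd N"
  shows "sin_cot (2 * N) x + sin_cot (2 * N) (x - real N) = 2 * sin_csc N x"
proof (cases "x \<in> int_multiples N")
  case True
  then obtain k where k: "x = real N * of_int k" by (auto simp: int_multiples_def)
  have N0: "N \<ge> 1" using N by (auto simp: Suc_leI odd_pos)
  \<comment> \<open>At \<open>x = N * k\<close> exactly one of \<open>k\<close> and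
    \<open>k - 1\<close> is even; that term contributes the limit value \<open>2 * N\<close> and the
    other one 0.\<close>
  have odd_zero: "sin_cot (2 * N) (real N * of_int j) = 0" if "odd j" for j
  proof -
    have "real N * of_int j \<notin> int_multiples (2 * N)"
    proof
      assume "real N * of_int j \<in> int_multiples (2 * N)"
      then obtain l where "real N * of_int j = real N * of_int (2 * l)" by (auto simp: int_multiples_def)
      then have "j = 2 * l" using N0 by (simp del: of_int_mult)
      with that show False by simp
    qed
    moreover have "sin (pi * (real N * of_int j)) = 0"
      using sin_npi_int[of "int N * j"] by simp
    ultimately show ?thesis by (simp add: sin_cot_nonmultiple)
  qed
  have even_val: "sin_cot (2 * N) (real N * of_int j) = 2 * real N" if even: "even j" for j
  proof -
    obtain l where "j = 2 * l" using even by auto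
    then show ?thesis using sin_cot_multiple[of "2 * N" l] N0 by (simp add: mult_ac)
  qed
  have "x - real N = real N * of_int (k - 1)" by (simp add: k algebra_simps)
  then show ?thesis
    using odd_zero[of k] odd_zero[of "k - 1"] even_val[of k] even_val[of "k - 1"]
    by (cases "even k") (simp_all add: k sin_csc_multiple[OF N])
next
  case False
  have N0: "real N > 0" using N by (simp add: odd_pos)
  \<comment> \<open>The multiples of \<open>N\<close> contain those of \<open>2 * N\<close> and are
    invariant under shifting by \<open>N\<close>, so both cotangent arguments avoid their
    singularities.\<close>
  have sub: "z \<in> int_multiples N" if z: "z \<in> int_multiples (2 * N)" for z
  proof -
    obtain k where "z = real (2 * N) * of_int k" using z unfolding int_multiples_def by blast
    then have "z = real N * of_int (2 * k)" by simp
    then show ?thesis unfolding int_multiples_def by blast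
  qed
  have "x - real N \<notin> int_multiples N"
  proof
    assume "x - real N \<in> int_multiples N"
    then obtain l where "x = real N * of_int (l + 1)" by (auto simp: int_multiples_def algebra_simps)
    with False show False unfolding int_multiples_def by blast
  qed
  then have nm: "x \<notin> int_multiples (2 * N)" "x - real N \<notin> int_multiples (2 * N)"
    using False sub by auto
  define w where "w = pi / real (2 * N) * x"
  have w: "pi / real N * x = 2 * w" "pi / real (2 * N) * (x - real N) = w - pi / 2"
    using N0 by (simp_all add: w_def field_simps)
  \<comment> \<open>Oddness of \<open>N\<close> supplies the minus sign that turns the sum of the
    two kernels into the difference \<open>cot w - cot (w - pi / 2)\<close>, that is,
    \<open>cot w + tan w\<close>.\<close>
  have s: "sin (pi * (x - real N)) = - sin (pi * x)"
  proof -
    have "pi * (x - real N) = pi * x - pi * of_int (int N)" by (simp add: algebra_simps)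
    then show ?thesis using N by (simp only: sin_diff sin_npi_int cos_npi_int) simp
  qed
  have "sin (2 * w) \<noteq> 0"
  proof
    assume "sin (2 * w) = 0"
    then obtain l where "2 * w = of_int l * pi" by (auto simp: sin_zero_iff_int2)
    then have "x = real N * of_int l" using N0 by (simp add: w_def field_simps)
    with False show False by (auto simp: int_multiples_def)
  qed
  then have nz: "sin w \<noteq> 0" "cos w \<noteq> 0" by (auto simp: sin_double)
  have "cot w - cot (w - pi / 2) = 2 * csc (2 * w)"
  proof -
    have "cot w - cot (w - pi / 2) = cos w / sin w + sin w / cos w"
      by (simp add: cot_def sin_diff cos_diff)
    also have "\<dots> = ((sin w)\<^sup>2 + (cos w)\<^sup>2) / (sin w * cos w)"
      using nz by (simp add: field_simps power2_eq_square)
    finally show ?thesis using nz by (simp add: csc_def sin_double)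
  qed
  then have "sin (pi * x) * (cot w - cot (w - pi / 2)) = sin (pi * x) * (2 * csc (2 * w))" by simp
  then show ?thesis
    unfolding sin_cot_nonmultiple[OF nm(1)] sin_cot_nonmultiple[OF nm(2)]
      sin_csc_nonmultiple[OF False] w s w_def[symmetric] by (simp add: algebra_simps)
qed

text \<open>Over the period \<open>2 * N\<close>, the residues \<open>r\<close> and
  \<open>N + r\<close> carry the same power of \<open>T\<close>. By \<open>sin_cot_double\<close>
  their coefficients merge into one cosecant term, whose factor 2 cancels that of
  \<open>2 * N\<close>.\<close>

lemma frac_power_partial_tendsto_odd:
  assumes N: "odd N" and T: "blinfun_pow T N = id_blinfun"
  shows "frac_power_partial T \<alpha> \<longlonglongrightarrow>
    (\<Sum>r<N. (sin_csc N (\<alpha> - real r) / real N) *\<^sub>R blinfun_pow T r)"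
proof -
  have T2: "blinfun_pow T (2 * N) = id_blinfun"
    unfolding mult.commute[of 2] blinfun_pow_mult T by (rule blinfun_pow_id)
  have per: "blinfun_pow T (N + r) = blinfun_pow T r" for r
    using blinfun_pow_mod[OF T, of "N + r"] blinfun_pow_mod[OF T, of r] by simp
  define g where "g = (\<lambda>r. (sin_cot (2 * N) (\<alpha> - real r) / real (2 * N)) *\<^sub>R blinfun_pow T r)"
  have "(\<Sum>r<2 * N. g r) = (\<Sum>r<N. g r) + (\<Sum>r<N. g (N + r))"
    using sum.atLeastLessThan_concat[of 0 N "2 * N" g] sum.shift_bounds_nat_ivl[of g 0 N N]
    by (simp add: lessThan_atLeast0 mult_2 add.commute)
  also have "\<dots> = (\<Sum>r<N. (sin_csc N (\<alpha> - real r) / real N) *\<^sub>R blinfun_pow T r)"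
    unfolding sum.distrib[symmetric]
  proof (intro sum.cong refl)
    fix r
    have shift: "\<alpha> - real (N + r) = \<alpha> - real r - real N" by simp
    show "g r + g (N + r) = (sin_csc N (\<alpha> - real r) / real N) *\<^sub>R blinfun_pow T r"
      using sin_cot_double[OF N, of "\<alpha> - real r"]
      by (simp add: g_def per shift scaleR_add_left[symmetric] add_divide_distrib[symmetric] del: of_nat_add)
  qed
  finally show ?thesis
    using frac_power_partial_tendsto_even[of "2 * N" T \<alpha>] T2 N unfolding g_def
    by (simp add: Suc_leI odd_pos)
qed

theorem theorem4:
  fixes T :: "'a::complex_banach \<Rightarrow>\<^sub>L 'a" and N :: nat and \<alpha> :: real
  assumes "complex_linear_op T"
    and "N \<ge> 1"
    and "blinfun_pow T N = id_blinfun"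
  shows "convergent (frac_power_partial T \<alpha>) \<and>
    frac_power T \<alpha> =
      (if even N
       then (1 / real N) *\<^sub>R (\<Sum>n\<in>{0..N - 1}. sin_cot N (\<alpha> - real n) *\<^sub>R blinfun_pow T n)
       else (1 / real N) *\<^sub>R (\<Sum>n\<in>{0..N - 1}. sin_csc N (\<alpha> - real n) *\<^sub>R blinfun_pow T n))"
    (is "_ \<and> _ = ?L")
proof -
  \<comment> \<open>Subtraction on naturals truncates, so this rests on
    \<open>N \<ge> 1\<close>.\<close>
  have "{0..N - 1} = {..<N}" using assms(2) by auto
  then have "frac_power_partial T \<alpha> \<longlonglongrightarrow> ?L"
    using frac_power_partial_tendsto_even[OF assms(2) _ assms(3), of \<alpha>]
      frac_power_partial_tendsto_odd[OF _ assms(3), of \<alpha>]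
    by (simp add: scaleR_sum_right)
  then show ?thesis
    unfolding frac_power_def by (auto intro: convergentI limI)
qed

end
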